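(* Let $r_1,r_2,\rho_1,\rho_2$ be real numbers with $g:=\rho_1+\rho_2-r_1-r_2\notin\{-1,-2,\dots\}$ and such that none of $\rho_1+\rho_2+1$, $\rho_2-r_1+\frac12$, $\rho_2-r_2+\frac12$ is a nonpositive integer. Let $P_n$ be the monic Bannai-Ito polynomials and $A_n$ their coefficients as defined in the context. Then $$W_n(x)=\frac{P_{n+1}(x)-A_nP_n(x)}{x-\rho_1},\qquad n\geq0,$$ (the complementary Bannai-Ito polynomials) are monic polynomials of degree $n$ satisfying $$W_{n+1}(x)+(-1)^n\rho_2W_n(x)+v_nW_{n-1}(x)=xW_n(x),$$ with $W_{-1}=0$, $v_0=0$ and $$v_{2n}=-\frac{n(n+\rho_1-r_1+\frac12)(n+\rho_1-r_2+\frac12)(n-r_1-r_2)}{(2n+1+g)(2n+g)}\quad(n\ge1),$$ $$v_{2n+1}=-\frac{(n+g+1)(n+\rho_1+\rho_2+1)(n+\rho_2-r_1+\frac12)(n+\rho_2-r_2+\frac12)}{(2n+1+g)(2n+g+2)}\quad(n\ge0).$$ Moreover $W_{2n}(x)=U_n(x^2)$ and $W_{2n+1}(x)=(x-\rho_2)V_n(x^2)$, where $U_n(x^2)$, $V_n(x^2)$ are the (Wilson) polynomials $$U_n(x^2)=\kappa^{(1)}_n\,{}_4F_3\!\left({-n,\ n+g+1,\ \rho_2+x,\ \rho_2-x\atop \rho_1+\rho_2+1,\ \rho_2-r_1+\frac12,\ \rho_2-r_2+\frac12};1\right),$$ $$V_n(x^2)=\kappa^{(2)}_n\,{}_4F_3\!\left({-n,\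 n+g+2,\ \rho_2+1+x,\ \rho_2+1-x\atop \rho_1+\rho_2+2,\ \rho_2-r_1+\frac32,\ \rho_2-r_2+\frac32};1\right),$$ $$\kappa^{(1)}_n=\frac{(1+\rho_1+\rho_2)_n(\rho_2-r_1+\frac12)_n(\rho_2-r_2+\frac12)_n}{(n+g+1)_n},\qquad \kappa^{(2)}_n=\frac{(2+\rho_1+\rho_2)_n(\rho_2-r_1+\frac32)_n(\rho_2-r_2+\frac32)_n}{(n+g+2)_n}.$$
   Context: The monic Bannai-Ito polynomials $P_n(x)=P_n(x;r_1,r_2,\rho_1,\rho_2)$ are defined by $P_{-1}=0$, $P_0=1$ and $$P_{n+1}(x)+(\rho_1-A_n-C_n)P_n(x)+A_{n-1}C_nP_{n-1}(x)=xP_n(x),$$ where, with $g=\rho_1+\rho_2-r_1-r_2$ and $C_0=0$, $$A_n=\begin{cases}\frac{(n+1+2\rho_1-2r_1)(n+1+2\rho_1-2r_2)}{4(n+1+g)},& n\text{ even},\\ \frac{(n+1+2g)(n+1+2\rho_1+2\rho_2)}{4(n+1+g)},& n\text{ odd},\end{cases}\qquad C_n=\begin{cases}-\frac{n(n-2r_1-2r_2)}{4(n+g)},& n\text{ even},\ n\ge 2,\\ -\frac{(n-2r_2+2\rho_2)(n-2r_1+2\rho_2)}{4(n+g)},& n\text{ odd}.\end{cases}$$ $(a)_n=a(a+1)\cdots(a+n-1)$, and ${}_4F_3$ is the (here terminating) generalized hypergeometric series. *)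

theory Defs
  imports "HOL-Analysis.Analysis" "HOL-Library.Nonpos_Ints"
begin

definition BI_g :: "real \<Rightarrow> real \<Rightarrow> real \<Rightarrow> real \<Rightarrow> real" where
  "BI_g r\<^sub>1 r\<^sub>2 \<rho>\<^sub>1 \<rho>\<^sub>2 = \<rho>\<^sub>1 + \<rho>\<^sub>2 - r\<^sub>1 - r\<^sub>2"

definition BI_A :: "real \<Rightarrow> real \<Rightarrow> real \<Rightarrow> real \<Rightarrow> nat \<Rightarrow> real" where
  "BI_A r\<^sub>1 r\<^sub>2 \<rho>\<^sub>1 \<rho>\<^sub>2 n =
     (let g = BI_g r\<^sub>1 r\<^sub>2 \<rho>\<^sub>1 \<rho>\<^sub>2 in
      if even n
      then (real n + 1 + 2 * \<rho>\<^sub>1 - 2 * r\<^sub>1) * (real n + 1 + 2 * \<rho>\<^sub>1 - 2 * r\<^sub>2) / (4 * (real n + 1 + g))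
      else (real n + 1 + 2 * g) * (real n + 1 + 2 * \<rho>\<^sub>1 + 2 * \<rho>\<^sub>2) / (4 * (real n + 1 + g)))"

definition BI_C :: "real \<Rightarrow> real \<Rightarrow> real \<Rightarrow> real \<Rightarrow> nat \<Rightarrow> real" where
  "BI_C r\<^sub>1 r\<^sub>2 \<rho>\<^sub>1 \<rho>\<^sub>2 n =
     (let g = BI_g r\<^sub>1 r\<^sub>2 \<rho>\<^sub>1 \<rho>\<^sub>2 in
      if n = 0 then 0
      else if even n
      then - (real n * (real n - 2 * r\<^sub>1 - 2 * r\<^sub>2) / (4 * (real n + g)))
      else - ((real n - 2 * r\<^sub>2 + 2 * \<rho>\<^sub>2) * (real n - 2 * r\<^sub>1 + 2 * \<rho>\<^sub>2) / (4 * (real n + g))))"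

text \<open>The conditional in the recursive equation implements the convention \<open>P\<^sub>-\<^sub>1 = 0\<close>.\<close>

fun BI_P :: "real \<Rightarrow> real \<Rightarrow> real \<Rightarrow> real \<Rightarrow> nat \<Rightarrow> real poly" where
  "BI_P r\<^sub>1 r\<^sub>2 \<rho>\<^sub>1 \<rho>\<^sub>2 0 = 1"
| "BI_P r\<^sub>1 r\<^sub>2 \<rho>\<^sub>1 \<rho>\<^sub>2 (Suc n) =
     [:0, 1:] * BI_P r\<^sub>1 r\<^sub>2 \<rho>\<^sub>1 \<rho>\<^sub>2 n
     - smult (\<rho>\<^sub>1 - BI_A r\<^sub>1 r\<^sub>2 \<rho>\<^sub>1 \<rho>\<^sub>2 n - BI_C r\<^sub>1 r\<^sub>2 \<rho>\<^sub>1 \<rho>\<^sub>2 n) (BI_P r\<^sub>1 r\<^sub>2 \<rho>\<^sub>1 \<rho>\<^sub>2 n)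
     - (if n = 0 then 0
        else smult (BI_A r\<^sub>1 r\<^sub>2 \<rho>\<^sub>1 \<rho>\<^sub>2 (n - 1) * BI_C r\<^sub>1 r\<^sub>2 \<rho>\<^sub>1 \<rho>\<^sub>2 n)
               (BI_P r\<^sub>1 r\<^sub>2 \<rho>\<^sub>1 \<rho>\<^sub>2 (n - 1)))"

text \<open>
  Polynomial division discards a remainder, so this definition alone does not say that
  \<open>x - \<rho>\<^sub>1\<close> divides the numerator; exactness of the division has to be stated separately.
\<close>

definition CBI_W :: "real \<Rightarrow> real \<Rightarrow> real \<Rightarrow> real \<Rightarrow> nat \<Rightarrow> real poly" where
  "CBI_W r\<^sub>1 r\<^sub>2 \<rho>\<^sub>1 \<rho>\<^sub>2 n =
     (BI_P r\<^sub>1 r\<^sub>2 \<rho>\<^sub>1 \<rho>\<^sub>2 (n + 1) - smult (BI_A r\<^sub>1 r\<^sub>2 \<rho>\<^sub>1 \<rho>\<^sub>2 n) (BI_P r\<^sub>1 r\<^sub>2 \<rho>\<^sub>1 \<rho>\<^sub>2 n))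
     div [:- \<rho>\<^sub>1, 1:]"

definition CBI_v :: "real \<Rightarrow> real \<Rightarrow> real \<Rightarrow> real \<Rightarrow> nat \<Rightarrow> real" where
  "CBI_v r\<^sub>1 r\<^sub>2 \<rho>\<^sub>1 \<rho>\<^sub>2 m =
     (let g = BI_g r\<^sub>1 r\<^sub>2 \<rho>\<^sub>1 \<rho>\<^sub>2; n = real (m div 2) in
      if m = 0 then 0
      else if even m
      then - (n * (n + \<rho>\<^sub>1 - r\<^sub>1 + 1/2) * (n + \<rho>\<^sub>1 - r\<^sub>2 + 1/2) * (n - r\<^sub>1 - r\<^sub>2)
              / ((2 * n + 1 + g) * (2 * n + g)))
      else - ((n + g + 1) * (n + \<rho>\<^sub>1 + \<rho>\<^sub>2 + 1) * (n + \<rho>\<^sub>2 - r\<^sub>1 + 1/2) * (n + \<rho>\<^sub>2 - r\<^sub>2 + 1/2)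
              / ((2 * n + 1 + g) * (2 * n + g + 2))))"

definition hypergeo_4F3 ::
  "real \<Rightarrow> real \<Rightarrow> real \<Rightarrow> real \<Rightarrow> real \<Rightarrow> real \<Rightarrow> real \<Rightarrow> real \<Rightarrow> real" where
  "hypergeo_4F3 a\<^sub>1 a\<^sub>2 a\<^sub>3 a\<^sub>4 b\<^sub>1 b\<^sub>2 b\<^sub>3 z =
     eval_fps (fps_hypergeo [a\<^sub>1, a\<^sub>2, a\<^sub>3, a\<^sub>4] [b\<^sub>1, b\<^sub>2, b\<^sub>3] 1) z"

definition CBI_kappa1 :: "real \<Rightarrow> real \<Rightarrow> real \<Rightarrow> real \<Rightarrow> nat \<Rightarrow> real" where
  "CBI_kappa1 r\<^sub>1 r\<^sub>2 \<rho>\<^sub>1 \<rho>\<^sub>2 n =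
     pochhammer (1 + \<rho>\<^sub>1 + \<rho>\<^sub>2) n * pochhammer (\<rho>\<^sub>2 - r\<^sub>1 + 1/2) n * pochhammer (\<rho>\<^sub>2 - r\<^sub>2 + 1/2) n
     / pochhammer (real n + BI_g r\<^sub>1 r\<^sub>2 \<rho>\<^sub>1 \<rho>\<^sub>2 + 1) n"

definition CBI_kappa2 :: "real \<Rightarrow> real \<Rightarrow> real \<Rightarrow> real \<Rightarrow> nat \<Rightarrow> real" where
  "CBI_kappa2 r\<^sub>1 r\<^sub>2 \<rho>\<^sub>1 \<rho>\<^sub>2 n =
     pochhammer (2 + \<rho>\<^sub>1 + \<rho>\<^sub>2) n * pochhammer (\<rho>\<^sub>2 - r\<^sub>1 + 3/2) n * pochhammer (\<rho>\<^sub>2 - r\<^sub>2 + 3/2) n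
     / pochhammer (real n + BI_g r\<^sub>1 r\<^sub>2 \<rho>\<^sub>1 \<rho>\<^sub>2 + 2) n"

end

theory Submission
  imports Defs
begin

text \<open>
  The theorem combines two facts about three-term recurrences with one fact about Wilson polynomials.

  The recurrence of \<open>P\<^sub>n\<close> says that the Jacobi matrix of \<open>x - \<rho>\<^sub>1\<close> is a product of two bidiagonal
  matrices, one with entries \<open>1, - C\<^sub>n\<close> and one with entries \<open>1, - A\<^sub>n\<close>. Exchanging the two
  factors is the Christoffel transform: the monic polynomials \<open>W\<^sub>n\<close> with recurrence coefficients \<open>\<rho>\<^sub>1 - A\<^sub>n - C\<^sub>n\<^sub>+\<^sub>1\<close> and \<open>A\<^sub>n C\<^sub>n\<close> satisfy
  \<open>P\<^sub>n = W\<^sub>n - C\<^sub>n W\<^sub>n\<^sub>-\<^sub>1\<close> and \<open>(x - \<rho>\<^sub>1) W\<^sub>n = P\<^sub>n\<^sub>+\<^sub>1 - A\<^sub>n P\<^sub>n\<close>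
  (\<open>monic_OP_christoffel\<close>). The second identity gives the exact division. For the Bannai-Ito
  coefficients the diagonal collapses to \<open>(-1)\<^sup>n \<rho>\<^sub>2\<close> and the off-diagonal product is \<open>v\<^sub>n\<close>.

  A recurrence with diagonal \<open>(-1)\<^sup>n s\<close> is a disguised recurrence in \<open>z = x\<^sup>2\<close>, because two consecutive
  steps multiply by \<open>(x + s) (x - s) = z - s\<^sup>2\<close>. Hence \<open>W\<^sub>2\<^sub>n = U\<^sub>n(x\<^sup>2)\<close> and
  \<open>W\<^sub>2\<^sub>n\<^sub>+\<^sub>1 = (x - s) V\<^sub>n(x\<^sup>2)\<close> as soon as \<open>U\<^sub>0 = V\<^sub>0 = 1\<close> and
  \<open>U\<^sub>n\<^sub>+\<^sub>1 = (z - s\<^sup>2) V\<^sub>n - v\<^sub>2\<^sub>n\<^sub>+\<^sub>1 U\<^sub>n\<close>, \<open>U\<^sub>n\<^sub>+\<^sub>1 = V\<^sub>n\<^sub>+\<^sub>1 + v\<^sub>2\<^sub>n\<^sub>+\<^sub>2 V\<^sub>n\<close>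
  (\<open>monic_OP_quadratic\<close>).

  It remains to see that the monic Wilson polynomials satisfy these two relations. The 4F3 series of
  \<open>V\<close> is that of \<open>U\<close> with \<open>s\<close>, the lower parameters and the upper parameter \<open>h = g + 1\<close> all raised
  by 1. Both are expanded in the products \<open>(s + x)\<^sub>k (s - x)\<^sub>k\<close> and \<open>(s + 1 + x)\<^sub>k (s + 1 - x)\<^sub>k\<close>.
  Multiplication by \<open>s\<^sup>2 - z\<close> maps the second basis into the first, shifting the index, and an element
  of the first basis is a combination of two elements of the second. So each relation reduces to a rational
  identity between a few coefficients (\<open>wilson_christoffel\<close>, \<open>wilson_geronimus\<close>); the second one uses the
  balancing condition \<open>a + b + c = h + 1 + 2 s\<close> of the series.
\<close>

section \<open>Pochhammer symbols with nonvanishing factors\<close>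

lemma pochhammer_nonzero:
  fixes a :: real
  assumes "a \<notin> \<int>\<^sub>\<le>\<^sub>0"
  shows "pochhammer a n \<noteq> 0"
  using assms by (auto simp: pochhammer_eq_0_iff)

lemma shift_nonzero:
  fixes a :: real
  assumes "a \<notin> \<int>\<^sub>\<le>\<^sub>0"
  shows "a + real n \<noteq> 0"
  using assms by (metis eq_neg_iff_add_eq_0 minus_of_nat_in_nonpos_Ints)

lemma shift_notin_nonpos_Ints:
  fixes a :: real
  assumes "a \<notin> \<int>\<^sub>\<le>\<^sub>0"
  shows "a + real n \<notin> \<int>\<^sub>\<le>\<^sub>0"
proof
  assume "a + real n \<in> \<int>\<^sub>\<le>\<^sub>0"
  then obtain m where "a + real n = - of_nat m" by (elim nonpos_Ints_cases')
  hence "a = - of_nat (m + n)" by simp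
  thus False using assms by (metis minus_of_nat_in_nonpos_Ints)
qed

lemma pochhammer_shift:
  fixes a :: real
  shows "a * pochhammer (a + 1) n = (a + real n) * pochhammer a n"
  by (metis pochhammer_rec pochhammer_rec')

lemma pochhammer_unshift:
  fixes a :: real
  assumes "a + real n \<noteq> 0"
  shows "pochhammer a n = a * pochhammer (a + 1) n / (a + real n)"
  using pochhammer_shift[of a n] assms by (simp add: field_simps)

lemma pochhammer_neg_shift:
  "(real n + 1 - real k) * pochhammer (- real (Suc n)) k = (real n + 1) * pochhammer (- real n) k"
  using pochhammer_shift[of "- real (Suc n)" k] by (simp add: algebra_simps)

section \<open>Coefficients of the monic Wilson polynomials\<close>

text \<open>
  The normalising factor in front makes the coefficient of \<open>(s + x)\<^sub>n (s - x)\<^sub>n\<close> equal to \<open>(-1)\<^sup>n\<close>, so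
  that the Wilson polynomial is monic in \<open>x\<^sup>2\<close>.
\<close>
definition wilson_coeff :: "real \<Rightarrow> real \<Rightarrow> real \<Rightarrow> real \<Rightarrow> nat \<Rightarrow> nat \<Rightarrow> real" where
  "wilson_coeff h a b c n k =
     pochhammer a n * pochhammer b n * pochhammer c n / pochhammer (real n + h) n *
     (pochhammer (- real n) k * pochhammer (real n + h) k /
      (pochhammer a k * pochhammer b k * pochhammer c k * fact k))"

lemma wilson_coeff_eq_0:
  assumes "n < k"
  shows "wilson_coeff h a b c n k = 0"
  using pochhammer_of_nat_eq_0_lemma[OF assms, where ?'a = real] by (simp add: wilson_coeff_def)

context
  fixes h a b c :: real
  assumes h: "h \<notin> \<int>\<^sub>\<le>\<^sub>0" and a: "a \<notin> \<int>\<^sub>\<le>\<^sub>0" and b: "b \<notin> \<int>\<^sub>\<le>\<^sub>0" and c: "c \<notin> \<int>\<^sub>\<le>\<^sub>0"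
begin

lemma params_nonzero: "a \<noteq> 0" "b \<noteq> 0" "c \<noteq> 0"
  using shift_nonzero[of _ 0] a b c by auto

lemma params_shift_nonzero: "a + real n \<noteq> 0" "pochhammer (a + 1) n \<noteq> 0" "pochhammer a n \<noteq> 0"
  "b + real n \<noteq> 0" "pochhammer (b + 1) n \<noteq> 0" "pochhammer b n \<noteq> 0"
  "c + real n \<noteq> 0" "pochhammer (c + 1) n \<noteq> 0" "pochhammer c n \<noteq> 0"
  using shift_nonzero pochhammer_nonzero shift_notin_nonpos_Ints[of _ 1] a b c by auto

lemma h_shift_nonzero: "h + real n \<noteq> 0"
  using shift_nonzero h by auto

lemma h_pochhammer_nonzero: "pochhammer (h + real n) k \<noteq> 0"
  using pochhammer_nonzero shift_notin_nonpos_Ints h by auto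

text \<open>
  The next two lemmas relate the coefficients to those with all parameters raised by 1. The ratios are
  free of Pochhammer symbols, which turns every relation between coefficients into a rational identity.
\<close>
lemma wilson_coeff_Suc_Suc:
  "wilson_coeff h a b c (Suc n) (Suc k) =
     - ((real n + 1) * (real n + h + 1 + real k) / ((2 * real n + h + 1) * (real k + 1))) *
     wilson_coeff (h + 1) (a + 1) (b + 1) (c + 1) n k"
proof -
  have 1: "pochhammer (- real (Suc n)) (Suc k) = - (real n + 1) * pochhammer (- real n) k"
    using pochhammer_rec[of "- real (Suc n)" k] by (simp add: algebra_simps)
  have 2: "pochhammer (real (Suc n) + h) (Suc k) = pochhammer (real n + (h + 1)) k * (real n + h + 1 + real k)" for k
    using pochhammer_Suc[of "real (Suc n) + h" k] by (simp add: algebra_simps)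
  have 3: "pochhammer (real n + (h + 1)) n \<noteq> 0" using h_pochhammer_nonzero[of "n+1" n] by (simp add: algebra_simps)
  have 4: "2 * real n + h + 1 \<noteq> 0" using h_shift_nonzero[of "2*n+1"] by (simp add: algebra_simps)
  show ?thesis
    using params_nonzero params_shift_nonzero[of n] params_shift_nonzero[of k] 3 4
    unfolding wilson_coeff_def 1 2
      pochhammer_rec[of a] pochhammer_rec[of b] pochhammer_rec[of c]
    by (simp add: divide_simps fact_Suc add_eq_0_iff) (simp add: algebra_simps)
qed

lemma wilson_coeff_Suc:
  "wilson_coeff h a b c n (Suc k) =
    (2 * real n + h) * (real k - real n) / ((a + real n) * (b + real n) * (c + real n) * (real k + 1)) *
     wilson_coeff (h + 1) (a + 1) (b + 1) (c + 1) n k"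
proof -
  have 2: "pochhammer (real n + h) (Suc k) = (real n + h) * pochhammer (real n + (h + 1)) k" for k
    using pochhammer_rec[of "real n + h" k] by (simp add: algebra_simps)
  have 3: "pochhammer (real n + (h + 1)) n \<noteq> 0" using h_pochhammer_nonzero[of "n+1" n] by (simp add: algebra_simps)
  have 4: "2 * real n + h \<noteq> 0" "real n + h \<noteq> 0" using h_shift_nonzero[of "2*n"] h_shift_nonzero[of "n"] by (simp_all add: algebra_simps)
  have 5: "pochhammer (real n + h) n = (real n + h) * pochhammer (real n + (h + 1)) n / (2 * real n + h)"
    using pochhammer_shift[of "real n + h" n] 4 by (simp add: field_simps)
  have 6: "pochhammer a n = a * pochhammer (a + 1) n / (a + real n)"
   "pochhammer b n = b * pochhammer (b + 1) n / (b + real n)"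
   "pochhammer c n = c * pochhammer (c + 1) n / (c + real n)"
    using params_shift_nonzero[of n] by (simp_all only: pochhammer_unshift not_False_eq_True)
  show ?thesis
    using params_nonzero params_shift_nonzero[of n] params_shift_nonzero[of k] 3 4
    unfolding wilson_coeff_def 2 5 6
      pochhammer_rec[of a] pochhammer_rec[of b] pochhammer_rec[of c]
      pochhammer_Suc[of "- real n"]
    by (simp add: divide_simps fact_Suc add_eq_0_iff)
qed

lemma wilson_coeff_0:
  "wilson_coeff h a b c (Suc n) 0 =
    (real n + h) * (real n + a) * (real n + b) * (real n + c) / ((2 * real n + h) * (2 * real n + h + 1)) *
    wilson_coeff h a b c n 0"
proof -
  have 3: "pochhammer (real n + h) n \<noteq> 0" using h_pochhammer_nonzero[of "n" n] by (simp add: algebra_simps)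
  have 4: "2 * real n + h \<noteq> 0" "2 * real n + h + 1 \<noteq> 0" "real n + h \<noteq> 0"
    using h_shift_nonzero[of "2*n"] h_shift_nonzero[of "2*n+1"] h_shift_nonzero[of "n"] by (simp_all add: algebra_simps)
  have 2: "pochhammer (real (Suc n) + h) (Suc n) = pochhammer (real n + h) n * (2 * real n + h) * (2 * real n + h + 1) / (real n + h)"
    using pochhammer_Suc[of "real (Suc n) + h" n] pochhammer_shift[of "real n + h" n] 4
    by (simp add: field_simps)
  show ?thesis
    using params_nonzero params_shift_nonzero[of n] 3 4
    unfolding wilson_coeff_def 2
      pochhammer_Suc[of a] pochhammer_Suc[of b] pochhammer_Suc[of c]
    by (simp add: divide_simps add_eq_0_iff) (simp add: add.commute)
qed

text \<open>
  The index of the raised coefficient is \<open>k\<close>, not \<open>Suc k\<close>, since multiplication by \<open>s\<^sup>2 - x\<^sup>2\<close> maps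
  \<open>(s + 1 + x)\<^sub>k (s + 1 - x)\<^sub>k\<close> to \<open>(s + x)\<^sub>k\<^sub>+\<^sub>1 (s - x)\<^sub>k\<^sub>+\<^sub>1\<close>. The index 0 is not reached in this
  way and is the subject of the preceding lemma.
\<close>
lemma wilson_coeff_christoffel:
  "wilson_coeff h a b c (Suc n) (Suc k) + wilson_coeff (h + 1) (a + 1) (b + 1) (c + 1) n k =
   (real n + h) * (real n + a) * (real n + b) * (real n + c) / ((2 * real n + h) * (2 * real n + h + 1))
    * wilson_coeff h a b c n (Suc k)"
proof -
  have 4: "2 * real n + h \<noteq> 0" "2 * real n + h + 1 \<noteq> 0"
    using h_shift_nonzero[of "2*n"] h_shift_nonzero[of "2*n+1"] by (simp_all add: algebra_simps)
  let ?w = "wilson_coeff (h + 1) (a + 1) (b + 1) (c + 1) n k"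
  have "(real n + h) * (real n + a) * (real n + b) * (real n + c) / ((2 * real n + h) * (2 * real n + h + 1))
    * wilson_coeff h a b c n (Suc k)
    = (real n + h) * (real k - real n) / ((2 * real n + h + 1) * (real k + 1)) * ?w"
    using params_nonzero params_shift_nonzero[of n] 4 unfolding wilson_coeff_Suc
    by (simp add: divide_simps add_eq_0_iff) (simp add: add.commute)
  also have "\<dots> = - ((real n + 1) * (real n + h + 1 + real k) / ((2 * real n + h + 1) * (real k + 1))) * ?w + ?w"
    using 4(2) by (simp add: divide_simps add_eq_0_iff) (simp add: algebra_simps)
  finally show ?thesis unfolding wilson_coeff_Suc_Suc by simp
qed

text \<open>
  The last term comes from rewriting \<open>(s + x)\<^sub>k\<^sub>+\<^sub>1 (s - x)\<^sub>k\<^sub>+\<^sub>1\<close> in the basis with \<open>s + 1\<close>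
  (\<open>wilson_basis_connection\<close>).
\<close>
lemma wilson_coeff_geronimus:
  assumes s: "a + b + c = h + 1 + 2 * s"
  shows "wilson_coeff (h + 1) (a + 1) (b + 1) (c + 1) (Suc n) k
     - (real n + 1) * (real n + 1 + h - a) * (real n + 1 + h - b) * (real n + 1 + h - c)
       / ((2 * real n + h + 2) * (2 * real n + h + 1)) * wilson_coeff (h + 1) (a + 1) (b + 1) (c + 1) n k
     = wilson_coeff h a b c (Suc n) k
     - (real k + 1) * (2 * s + real k + 1) * wilson_coeff h a b c (Suc n) (Suc k)"
proof -
  define N K where "N = real n" "K = real k"
  have 4: "2 * N + h + 1 \<noteq> 0" "2 * N + h + 2 \<noteq> 0" "2 * N + h + 3 \<noteq> 0" "N + h + 1 \<noteq> 0" "N + h + 2 \<noteq> 0"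
    using h_shift_nonzero[of "2*n+1"] h_shift_nonzero[of "2*n+2"]
      h_shift_nonzero[of "2*n+3"] h_shift_nonzero[of "n+1"] h_shift_nonzero[of "n+2"]
    unfolding N_K_def by (simp_all add: algebra_simps)
  have s': "s = (a + b + c - h - 1) / 2" using s by simp
  \<comment> \<open>All four coefficients are rational multiples of \<open>w\<close>. It contains the symbol of \<open>- (n + 1)\<close> rather
    than that of \<open>- n\<close>, which vanishes at \<open>k = n + 1\<close> although two of these coefficients do not.\<close>
  define w where "w = pochhammer (a + 1) n * pochhammer (b + 1) n * pochhammer (c + 1) n / pochhammer (real n + h + 1) n *
     (pochhammer (- real (Suc n)) k * pochhammer (real n + h + 1) k /
      (pochhammer (a+1) k * pochhammer (b+1) k * pochhammer (c+1) k * fact k))"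
  have 3: "pochhammer (real n + (h + 1)) n \<noteq> 0" using h_pochhammer_nonzero[of "n+1" n] by (simp add: algebra_simps)
  have p: "pochhammer (- real n) k = (N + 1 - K) / (N + 1) * pochhammer (- real (Suc n)) k"
    using pochhammer_neg_shift[of n k] by (simp add: N_K_def divide_simps add_eq_0_iff del: of_nat_Suc)
  have e1: "wilson_coeff (h + 1) (a + 1) (b + 1) (c + 1) n k = (N + 1 - K) / (N + 1) * w"
    unfolding wilson_coeff_def w_def p by (simp add: add.assoc mult_ac)
  have e2: "wilson_coeff h a b c (Suc n) (Suc k) =
     - ((N + h + 1 + K) * (N + 1 - K) / ((2 * N + h + 1) * (K + 1))) * w"
    using 4 unfolding wilson_coeff_Suc_Suc e1 by (simp add: N_K_def divide_simps add_eq_0_iff)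
  have P: "pochhammer (real n + h + 2) m = (N + h + 1 + real m) / (N + h + 1) * pochhammer (real n + h + 1) m" for m
    using pochhammer_shift[of "real n + h + 1" m] 4 by (simp add: N_K_def divide_simps) (simp add: algebra_simps)
  have Q: "pochhammer (real (Suc n) + h) (Suc n) = pochhammer (real n + h + 1) n * (2 * N + h + 1)"
    using pochhammer_Suc[of "real (Suc n) + h" n] by (simp add: algebra_simps N_K_def)
  have R: "pochhammer (real (Suc n) + (h + 1)) (Suc n) = pochhammer (real n + h + 1) n * (2 * N + h + 1) * (2 * N + h + 2) / (N + h + 1)"
  proof -
    have "pochhammer (real (Suc n) + (h + 1)) (Suc n) = pochhammer (real n + h + 2) n * (2 * N + h + 2)"
      using pochhammer_Suc[of "real (Suc n) + (h + 1)" n] by (simp add: algebra_simps N_K_def)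
    thus ?thesis unfolding P by (simp add: N_K_def algebra_simps)
  qed
  have S: "pochhammer a k = a * pochhammer (a + 1) k / (a + K)"
   "pochhammer b k = b * pochhammer (b + 1) k / (b + K)"
   "pochhammer c k = c * pochhammer (c + 1) k / (c + K)"
    using params_shift_nonzero[of k] by (simp_all only: pochhammer_unshift N_K_def not_False_eq_True)
  have T: "real (Suc n) + h = real n + h + 1" "real (Suc n) + (h + 1) = real n + h + 2" by simp_all
  have e3: "wilson_coeff h a b c (Suc n) k = (a + K) * (b + K) * (c + K) / (2 * N + h + 1) * w"
    using params_nonzero params_shift_nonzero[of n] params_shift_nonzero[of k] 3 4
    unfolding wilson_coeff_def w_def Q S
      pochhammer_rec[of a n] pochhammer_rec[of b n] pochhammer_rec[of c n]
    unfolding T N_K_def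
    by (simp add: divide_simps add_eq_0_iff del: of_nat_Suc)
  have e4: "wilson_coeff (h + 1) (a + 1) (b + 1) (c + 1) (Suc n) k =
    (a + 1 + N) * (b + 1 + N) * (c + 1 + N) * (N + h + 1 + K) / ((2 * N + h + 1) * (2 * N + h + 2)) * w"
    using params_nonzero params_shift_nonzero[of n] params_shift_nonzero[of k] 3 4
    unfolding wilson_coeff_def w_def R
      pochhammer_Suc[of "a+1" n] pochhammer_Suc[of "b+1" n] pochhammer_Suc[of "c+1" n]
    unfolding T P N_K_def
    by (simp add: divide_simps add_eq_0_iff del: of_nat_Suc)
  have N: "N + 1 \<noteq> 0" "K + 1 \<noteq> 0" by (auto simp: N_K_def)
  have e2': "(K + 1) * (2 * s + K + 1) * wilson_coeff h a b c (Suc n) (Suc k)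
      = - ((2 * s + K + 1) * ((N + h + 1 + K) * (N + 1 - K)) / (2 * N + h + 1)) * w"
    unfolding e2 using 4 N(2) by (simp add: divide_simps)
  have comb: "\<alpha> * w - r * (\<beta> * w) = \<gamma> * w - - \<delta> * w" if "\<alpha> - r * \<beta> = \<gamma> + \<delta>" for \<alpha> r \<beta> \<gamma> \<delta> :: real
    using arg_cong[OF that, of "\<lambda>t. t * w"] by (simp add: left_diff_distrib distrib_right mult.assoc)
  have "(a + 1 + N) * (b + 1 + N) * (c + 1 + N) * (N + h + 1 + K) / ((2 * N + h + 1) * (2 * N + h + 2))
     - (N + 1) * (N + 1 + h - a) * (N + 1 + h - b) * (N + 1 + h - c)
       / ((2 * N + h + 2) * (2 * N + h + 1)) * ((N + 1 - K) / (N + 1))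
     = (a + K) * (b + K) * (c + K) / (2 * N + h + 1)
     + (2 * s + K + 1) * ((N + h + 1 + K) * (N + 1 - K)) / (2 * N + h + 1)"
    using 4 N unfolding s' by (simp add: divide_simps) algebra
  from comb[OF this] show ?thesis
    unfolding e1 e3 e4 N_K_def(2)[symmetric] e2' unfolding N_K_def(1)[symmetric] .
qed

end

section \<open>Contiguous relations of the monic Wilson polynomials\<close>

text \<open>The argument of these polynomials is \<open>z = x\<^sup>2\<close>, in which \<open>(s + x)\<^sub>k (s - x)\<^sub>k\<close> factors linearly.\<close>
definition wilson_basis :: "real \<Rightarrow> nat \<Rightarrow> real poly" where
  "wilson_basis s k = (\<Prod>j<k. [:(s + real j)\<^sup>2, -1:])"

definition wilson :: "real \<Rightarrow> real \<Rightarrow> real \<Rightarrow> real \<Rightarrow> real \<Rightarrow> nat \<Rightarrow> real poly" where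
  "wilson s h a b c n = (\<Sum>k\<le>n. smult (wilson_coeff h a b c n k) (wilson_basis s k))"

lemma wilson_eq_sum_atMost:
  assumes "n \<le> m"
  shows "wilson s h a b c n = (\<Sum>k\<le>m. smult (wilson_coeff h a b c n k) (wilson_basis s k))"
  unfolding wilson_def using assms
  by (intro sum.mono_neutral_left) (auto simp: wilson_coeff_eq_0)

lemma wilson_0: "wilson s h a b c 0 = 1"
  by (simp add: wilson_def wilson_coeff_def wilson_basis_def)

lemma wilson_basis_0: "wilson_basis s 0 = 1"
  by (simp add: wilson_basis_def)

lemma wilson_basis_Suc: "wilson_basis s (Suc k) = wilson_basis s k * [:(s + real k)\<^sup>2, -1:]"
  by (simp add: wilson_basis_def)

lemma wilson_basis_rec: "wilson_basis s (Suc k) = [:s\<^sup>2, -1:] * wilson_basis (s + 1) k"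
  by (simp add: wilson_basis_def prod.lessThan_Suc_shift add_ac del: prod.lessThan_Suc)

lemma poly_ext:
  fixes p q :: "real poly"
  assumes "\<And>x. poly p x = poly q x"
  shows "p = q"
  using assms poly_eq_poly_eq_iff by blast

text \<open>
  The first factor \<open>s\<^sup>2 - z\<close> of the left side differs from \<open>(s + k + 1)\<^sup>2 - z\<close>, the last factor of the
  longer product on the right, by a constant.
\<close>
lemma wilson_basis_connection:
  "wilson_basis s (Suc k) =
     wilson_basis (s + 1) (Suc k) - smult ((real k + 1) * (2 * s + real k + 1)) (wilson_basis (s + 1) k)"
proof (rule poly_ext)
  fix x
  show "poly (wilson_basis s (Suc k)) x = poly (wilson_basis (s + 1) (Suc k) -
    smult ((real k + 1) * (2 * s + real k + 1)) (wilson_basis (s + 1) k)) x"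
    unfolding wilson_basis_rec[of s] wilson_basis_Suc[of "s + 1"]
    by (simp add: power2_eq_square algebra_simps)
qed

lemma smult_sum2: "smult c (\<Sum>i\<in>S. f i) = (\<Sum>i\<in>S. smult c (f i))"
  by (induction S rule: infinite_finite_induct) (simp_all add: smult_add_right)

text \<open>
  In terms of orthogonality this is a Christoffel transform: the raised polynomials belong to the
  functional multiplied by \<open>z - s\<^sup>2\<close>.
\<close>
lemma wilson_christoffel:
  assumes "h \<notin> \<int>\<^sub>\<le>\<^sub>0" "a \<notin> \<int>\<^sub>\<le>\<^sub>0" "b \<notin> \<int>\<^sub>\<le>\<^sub>0" "c \<notin> \<int>\<^sub>\<le>\<^sub>0"
  shows "wilson s h a b c (Suc n) =
    [:- s\<^sup>2, 1:] * wilson (s + 1) (h + 1) (a + 1) (b + 1) (c + 1) n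
    + smult ((real n + h) * (real n + a) * (real n + b) * (real n + c) / ((2 * real n + h) * (2 * real n + h + 1)))
       (wilson s h a b c n)" (is "_ = ?L * _ + smult ?r _")
proof -
  let ?u = "wilson_coeff h a b c" and ?w = "wilson_coeff (h + 1) (a + 1) (b + 1) (c + 1)"
  have L: "?L * wilson_basis (s + 1) k = - wilson_basis s (Suc k)" for k
    unfolding wilson_basis_rec by simp
  have "wilson s h a b c (Suc n) = [:?u (Suc n) 0:] + (\<Sum>k\<le>n. smult (?u (Suc n) (Suc k)) (wilson_basis s (Suc k)))"
    unfolding wilson_def by (simp add: sum.atMost_Suc_shift wilson_basis_0 del: sum.atMost_Suc)
  also have "(\<Sum>k\<le>n. smult (?u (Suc n) (Suc k)) (wilson_basis s (Suc k))) =
      (\<Sum>k\<le>n. ?L * smult (?w n k) (wilson_basis (s + 1) k)) +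
      (\<Sum>k\<le>n. smult ?r (smult (?u n (Suc k)) (wilson_basis s (Suc k))))"
    unfolding sum.distrib[symmetric]
  proof (rule sum.cong[OF refl])
    fix k
    have e: "?u (Suc n) (Suc k) = ?r * ?u n (Suc k) - ?w n k"
      using wilson_coeff_christoffel[OF assms, of n k] by simp
    show "smult (?u (Suc n) (Suc k)) (wilson_basis s (Suc k)) =
       ?L * smult (?w n k) (wilson_basis (s + 1) k) + smult ?r (smult (?u n (Suc k)) (wilson_basis s (Suc k)))"
      unfolding mult_smult_right L e by (simp add: smult_diff_left)
  qed
  also have "[:?u (Suc n) 0:] = smult ?r [:?u n 0:]"
    using wilson_coeff_0[OF assms, of n] by simp
  also have "smult ?r [:?u n 0:] + ((\<Sum>k\<le>n. ?L * smult (?w n k) (wilson_basis (s + 1) k)) +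
      (\<Sum>k\<le>n. smult ?r (smult (?u n (Suc k)) (wilson_basis s (Suc k)))))
    = ?L * wilson (s + 1) (h + 1) (a + 1) (b + 1) (c + 1) n +
      smult ?r (\<Sum>k\<le>Suc n. smult (?u n k) (wilson_basis s k))"
    unfolding sum.atMost_Suc_shift wilson_def sum_distrib_left smult_sum2 smult_add_right
    by (simp add: wilson_basis_0)
  finally show ?thesis
    using wilson_eq_sum_atMost[of n "Suc n" s h a b c] by simp
qed

text \<open>The inverse (Geronimus) transform, which expresses the original polynomials through the raised ones.\<close>
lemma wilson_geronimus:
  assumes "h \<notin> \<int>\<^sub>\<le>\<^sub>0" "a \<notin> \<int>\<^sub>\<le>\<^sub>0" "b \<notin> \<int>\<^sub>\<le>\<^sub>0" "c \<notin> \<int>\<^sub>\<le>\<^sub>0"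
    and s: "a + b + c = h + 1 + 2 * s"
  shows "wilson s h a b c (Suc n) =
    wilson (s + 1) (h + 1) (a + 1) (b + 1) (c + 1) (Suc n)
    - smult ((real n + 1) * (real n + 1 + h - a) * (real n + 1 + h - b) * (real n + 1 + h - c)
       / ((2 * real n + h + 2) * (2 * real n + h + 1)))
       (wilson (s + 1) (h + 1) (a + 1) (b + 1) (c + 1) n)" (is "_ = _ - smult ?r _")
proof -
  let ?u = "wilson_coeff h a b c (Suc n)" and ?w = "wilson_coeff (h + 1) (a + 1) (b + 1) (c + 1)"
  let ?B = "wilson_basis (s + 1)"
  let ?q = "\<lambda>k. (real k + 1) * (2 * s + real k + 1)"
  have "wilson s h a b c (Suc n) = [:?u 0:] + (\<Sum>k\<le>n. smult (?u (Suc k)) (wilson_basis s (Suc k)))"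
    unfolding wilson_def by (simp add: sum.atMost_Suc_shift wilson_basis_0 del: sum.atMost_Suc)
  also have "(\<Sum>k\<le>n. smult (?u (Suc k)) (wilson_basis s (Suc k))) =
      (\<Sum>k\<le>n. smult (?u (Suc k)) (?B (Suc k))) - (\<Sum>k\<le>n. smult (?q k * ?u (Suc k)) (?B k))"
    unfolding sum_subtractf[symmetric] wilson_basis_connection[of s]
    by (simp add: smult_diff_right mult_ac)
  also have "(\<Sum>k\<le>n. smult (?q k * ?u (Suc k)) (?B k)) = (\<Sum>k\<le>Suc n. smult (?q k * ?u (Suc k)) (?B k))"
    by (simp add: wilson_coeff_eq_0)
  also have "[:?u 0:] + ((\<Sum>k\<le>n. smult (?u (Suc k)) (?B (Suc k))) - (\<Sum>k\<le>Suc n. smult (?q k * ?u (Suc k)) (?B k)))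
      = (\<Sum>k\<le>Suc n. smult (?u k) (?B k)) - (\<Sum>k\<le>Suc n. smult (?q k * ?u (Suc k)) (?B k))"
    unfolding sum.atMost_Suc_shift[of "\<lambda>k. smult (?u k) (?B k)"] by (simp add: wilson_basis_0)
  also have "\<dots> = (\<Sum>k\<le>Suc n. smult (?w (Suc n) k) (?B k) - smult ?r (smult (?w n k) (?B k)))"
    unfolding sum_subtractf[symmetric] smult_diff_left[symmetric] smult_smult
    using wilson_coeff_geronimus[OF assms, of n] by simp
  also have "\<dots> = wilson (s + 1) (h + 1) (a + 1) (b + 1) (c + 1) (Suc n)
    - smult ?r (\<Sum>k\<le>Suc n. smult (?w n k) (?B k))"
    unfolding sum_subtractf smult_sum2 wilson_def ..
  finally show ?thesis
    using wilson_eq_sum_atMost[of n "Suc n" "s+1" "h+1" "a+1" "b+1" "c+1"] by simp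
qed

section \<open>Wilson polynomials as terminating hypergeometric series\<close>

lemma poly_wilson_basis:
  "poly (wilson_basis s k) (x\<^sup>2) = pochhammer (s + x) k * pochhammer (s - x) k"
  by (induction k) (simp_all add: wilson_basis_0 wilson_basis_Suc pochhammer_Suc power2_eq_square algebra_simps)

lemma hypergeo_4F3_terminating:
  "hypergeo_4F3 (- real n) a\<^sub>2 a\<^sub>3 a\<^sub>4 b\<^sub>1 b\<^sub>2 b\<^sub>3 z =
    (\<Sum>k\<le>n. pochhammer (- real n) k * pochhammer a\<^sub>2 k * pochhammer a\<^sub>3 k * pochhammer a\<^sub>4 k /
      (pochhammer b\<^sub>1 k * pochhammer b\<^sub>2 k * pochhammer b\<^sub>3 k * fact k) * z ^ k)"
  unfolding hypergeo_4F3_def eval_fps_def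
  by (subst suminf_finite[of "{..n}"]) (auto simp: pochhammer_of_nat_eq_0_lemma)

lemma poly_wilson:
  "poly (wilson s h a b c n) (x\<^sup>2) =
     pochhammer a n * pochhammer b n * pochhammer c n / pochhammer (real n + h) n *
     hypergeo_4F3 (- real n) (real n + h) (s + x) (s - x) a b c 1"
  by (simp add: hypergeo_4F3_terminating wilson_def poly_sum poly_wilson_basis wilson_coeff_def sum_distrib_left mult_ac)

section \<open>Monic three-term recurrences\<close>

fun monic_OP :: "(nat \<Rightarrow> real) \<Rightarrow> (nat \<Rightarrow> real) \<Rightarrow> nat \<Rightarrow> real poly" where
  "monic_OP b v 0 = 1"
| "monic_OP b v (Suc 0) = [:- b 0, 1:]"
| "monic_OP b v (Suc (Suc n)) =
     [:- b (Suc n), 1:] * monic_OP b v (Suc n) - smult (v (Suc n)) (monic_OP b v n)"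

lemma monic_OP_monic:
  "degree (monic_OP b v n) = n \<and> lead_coeff (monic_OP b v n) = 1"
proof -
  have "degree (monic_OP b v n) \<le> n \<and> coeff (monic_OP b v n) n = 1"
  proof (induction b v n rule: monic_OP.induct)
    case (3 b v n)
    have "degree ([:- b (Suc n), 1:] * monic_OP b v (Suc n)) \<le> Suc (Suc n)"
      using 3 degree_mult_le[of "[:- b (Suc n), 1:]" "monic_OP b v (Suc n)"] by simp
    moreover have "coeff (monic_OP b v n) (Suc (Suc n)) = 0" "coeff (monic_OP b v (Suc n)) (Suc (Suc n)) = 0"
      using 3 by (auto intro!: coeff_eq_0)
    ultimately show ?case using 3
      by (auto intro!: degree_diff_le order.trans[OF degree_smult_le])
  qed auto
  thus ?thesis by (metis le_antisym le_degree zero_neq_one)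
qed

lemma monic_OP_rec:
  "monic_OP b v (n + 1) + smult (b n) (monic_OP b v n)
     + smult (v n) (if n = 0 then 0 else monic_OP b v (n - 1)) = [:0, 1:] * monic_OP b v n"
  by (cases n) simp_all

text \<open>
  The induction carries the inverse relation \<open>P\<^sub>n\<^sub>+\<^sub>1 = W\<^sub>n\<^sub>+\<^sub>1 - C\<^sub>n\<^sub>+\<^sub>1 W\<^sub>n\<close> along. Multiplying it
  by \<open>x - l\<close> and inserting the claim for \<open>n\<close> yields the claim for \<open>n + 1\<close>, since the recurrence of
  \<open>P\<close> has the same terms.
\<close>
lemma monic_OP_christoffel:
  fixes A C :: "nat \<Rightarrow> real" and l :: real
  assumes C0: "C 0 = 0"
  defines "P \<equiv> monic_OP (\<lambda>n. l - A n - C n) (\<lambda>n. A (n - 1) * C n)"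
    and "W \<equiv> monic_OP (\<lambda>n. l - A n - C (Suc n)) (\<lambda>n. A n * C n)"
  shows "[:- l, 1:] * W n = P (Suc n) - smult (A n) (P n)"
proof -
  have "P (Suc n) = W (Suc n) - smult (C (Suc n)) (W n) \<and> [:- l, 1:] * W n = P (Suc n) - smult (A n) (P n)"
  proof (induction n)
    case 0
    show ?case by (simp add: W_def P_def C0)
  next
    case (Suc n)
    have "P (Suc (Suc n)) = [:- l, 1:] * P (Suc n) + smult (A (Suc n) + C (Suc n)) (P (Suc n))
          - smult (A n * C (Suc n)) (P n)"
      by (simp add: P_def algebra_simps smult_add_left smult_diff_left)
    also have "[:- l, 1:] * P (Suc n) = [:- l, 1:] * W (Suc n) - smult (C (Suc n)) (P (Suc n) - smult (A n) (P n))"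
      using Suc by (metis mult_smult_right right_diff_distrib)
    also have "\<dots> + smult (A (Suc n) + C (Suc n)) (P (Suc n)) - smult (A n * C (Suc n)) (P n)
       = [:- l, 1:] * W (Suc n) + smult (A (Suc n)) (P (Suc n))"
      by (simp add: algebra_simps smult_add_left smult_diff_right)
    finally have *: "[:- l, 1:] * W (Suc n) = P (Suc (Suc n)) - smult (A (Suc n)) (P (Suc n))"
      by simp
    hence "P (Suc (Suc n)) = [:- l, 1:] * W (Suc n) + smult (A (Suc n)) (W (Suc n) - smult (C (Suc n)) (W n))"
      using Suc by (metis diff_add_cancel)
    also have "\<dots> = W (Suc (Suc n)) - smult (C (Suc (Suc n))) (W (Suc n))"
      by (simp add: W_def algebra_simps smult_add_left smult_diff_left smult_diff_right)
    finally show ?case using * by blast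
  qed
  thus ?thesis by blast
qed

text \<open>
  One step of the recurrence from an even index and one from an odd index multiply by \<open>x - s\<close> and
  \<open>x + s\<close>, and the off-diagonal terms preserve parity up to the common factor \<open>x - s\<close>.
\<close>
lemma monic_OP_quadratic:
  fixes U V :: "nat \<Rightarrow> real poly" and s :: real
  assumes UV0: "U 0 = 1" "V 0 = 1"
    and U: "\<And>n. U (Suc n) = [:- s\<^sup>2, 1:] * V n - smult (v (2 * n + 1)) (U n)"
    and V: "\<And>n. U (Suc n) = V (Suc n) + smult (v (2 * n + 2)) (V n)"
  defines "W \<equiv> monic_OP (\<lambda>n. (- 1) ^ n * s) v"
  shows "W (2 * n) = pcompose (U n) (monom 1 2) \<and>
         W (2 * n + 1) = [:- s, 1:] * pcompose (V n) (monom 1 2)"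
proof (induction n)
  case 0
  show ?case by (simp add: W_def UV0 pcompose_1)
next
  case (Suc n)
  have sq: "pcompose [:- s\<^sup>2, 1:] (monom 1 2) = [:s, 1:] * [:- s, 1:]"
    by (simp add: pcompose_pCons monom_altdef power2_eq_square)
  have "W (2 * Suc n) = [:s, 1:] * W (2 * n + 1) - smult (v (2 * n + 1)) (W (2 * n))"
    by (simp add: W_def)
  also have "\<dots> = pcompose (U (Suc n)) (monom 1 2)"
    unfolding Suc[THEN conjunct1] Suc[THEN conjunct2] U pcompose_diff pcompose_mult pcompose_smult sq
    by (simp only: mult.assoc)
  finally have even: "W (2 * Suc n) = pcompose (U (Suc n)) (monom 1 2)" .
  have "W (2 * Suc n + 1) = [:- s, 1:] * W (2 * Suc n) - smult (v (2 * n + 2)) (W (2 * n + 1))"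
    by (simp add: W_def)
  also have "\<dots> = [:- s, 1:] * pcompose (V (Suc n)) (monom 1 2)"
    unfolding even Suc[THEN conjunct2] V pcompose_add pcompose_smult by (simp only: algebra_simps mult_smult_right)
  finally show ?case using even by blast
qed

section \<open>Bannai-Ito and complementary Bannai-Ito polynomials\<close>

lemma BI_P_eq_monic_OP:
  "BI_P r\<^sub>1 r\<^sub>2 \<rho>\<^sub>1 \<rho>\<^sub>2 n =
     monic_OP (\<lambda>n. \<rho>\<^sub>1 - BI_A r\<^sub>1 r\<^sub>2 \<rho>\<^sub>1 \<rho>\<^sub>2 n - BI_C r\<^sub>1 r\<^sub>2 \<rho>\<^sub>1 \<rho>\<^sub>2 n)
       (\<lambda>n. BI_A r\<^sub>1 r\<^sub>2 \<rho>\<^sub>1 \<rho>\<^sub>2 (n - 1) * BI_C r\<^sub>1 r\<^sub>2 \<rho>\<^sub>1 \<rho>\<^sub>2 n) n"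
proof (induction n rule: induct_nat_012)
  case (ge2 n)
  thus ?case by (simp add: smult_diff_left algebra_simps)
qed simp_all

lemma BI_A_C_sum:
  assumes "real n + 1 + BI_g r\<^sub>1 r\<^sub>2 \<rho>\<^sub>1 \<rho>\<^sub>2 \<noteq> 0"
  shows "\<rho>\<^sub>1 - BI_A r\<^sub>1 r\<^sub>2 \<rho>\<^sub>1 \<rho>\<^sub>2 n - BI_C r\<^sub>1 r\<^sub>2 \<rho>\<^sub>1 \<rho>\<^sub>2 (Suc n) = (- 1) ^ n * \<rho>\<^sub>2"
proof -
  define y where "y = real n + 1"
  define g where "g = BI_g r\<^sub>1 r\<^sub>2 \<rho>\<^sub>1 \<rho>\<^sub>2"
  have g: "g = \<rho>\<^sub>1 + \<rho>\<^sub>2 - r\<^sub>1 - r\<^sub>2" by (simp add: g_def BI_g_def)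
  have nz: "y + g \<noteq> 0" using assms by (simp add: y_def g_def)
  have y': "real (Suc n) = y" by (simp add: y_def)
  show ?thesis
  proof (cases "even n")
    case True
    have "\<rho>\<^sub>1 - (y + 2 * \<rho>\<^sub>1 - 2 * r\<^sub>1) * (y + 2 * \<rho>\<^sub>1 - 2 * r\<^sub>2) / (4 * (y + g))
       - - ((y - 2 * r\<^sub>2 + 2 * \<rho>\<^sub>2) * (y - 2 * r\<^sub>1 + 2 * \<rho>\<^sub>2) / (4 * (y + g))) = \<rho>\<^sub>2"
      using nz by (simp add: divide_simps) (simp add: g algebra_simps)
    thus ?thesis using True unfolding BI_A_def BI_C_def Let_def g_def[symmetric] y' y_def[symmetric] by simp
  next
    case False
    have "\<rho>\<^sub>1 - (y + 2 * g) * (y + 2 * \<rho>\<^sub>1 + 2 * \<rho>\<^sub>2) / (4 * (y + g))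
       - - (y * (y - 2 * r\<^sub>1 - 2 * r\<^sub>2) / (4 * (y + g))) = - \<rho>\<^sub>2"
      using nz by (simp add: divide_simps) (simp add: g algebra_simps)
    thus ?thesis using False unfolding BI_A_def BI_C_def Let_def g_def[symmetric] y' y_def[symmetric] by simp
  qed
qed

lemma BI_A_C_prod:
  "BI_A r\<^sub>1 r\<^sub>2 \<rho>\<^sub>1 \<rho>\<^sub>2 n * BI_C r\<^sub>1 r\<^sub>2 \<rho>\<^sub>1 \<rho>\<^sub>2 n = CBI_v r\<^sub>1 r\<^sub>2 \<rho>\<^sub>1 \<rho>\<^sub>2 n"
proof -
  have *: "X / (4 * p) * - (Y / (4 * q)) = - (Z / (p * q))" if "X * Y = 16 * Z" for X Y Z p q :: real
    using that by simp
  define g where "g = BI_g r\<^sub>1 r\<^sub>2 \<rho>\<^sub>1 \<rho>\<^sub>2"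
  consider "n = 0" | m where "n = 2 * m" "m \<noteq> 0" | m where "n = 2 * m + 1"
    by (metis evenE mult_0_right oddE)
  thus ?thesis
  proof cases
    case 1
    thus ?thesis by (simp add: BI_C_def CBI_v_def)
  next
    case (2 m)
    define x where "x = real m"
    have "real n = 2 * x" "real (n div 2) = x" using 2 by (simp_all add: x_def)
    moreover have "even n" "n \<noteq> 0" using 2 by simp_all
    ultimately show ?thesis
      unfolding BI_A_def BI_C_def CBI_v_def Let_def g_def[symmetric]
      by (simp only: if_True if_False) (rule *, simp add: field_simps)
  next
    case (3 m)
    define x where "x = real m"
    have "real n = 2 * x + 1" "real (n div 2) = x" using 3 by (simp_all add: x_def)
    moreover have "\<not> even n" "n \<noteq> 0" using 3 by simp_all
    moreover have "- (Z / ((2 * x + 1 + g) * (2 * x + g + 2))) = - (Z / ((2 * x + 1 + 1 + g) * (2 * x + 1 + g)))" for Z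
      by (simp add: algebra_simps)
    ultimately show ?thesis
      unfolding BI_A_def BI_C_def CBI_v_def Let_def g_def[symmetric]
      by (simp only: if_True if_False) (rule *, simp add: g_def BI_g_def field_simps)
  qed
qed

lemma CBI_division:
  assumes "\<And>n. real n + 1 + BI_g r\<^sub>1 r\<^sub>2 \<rho>\<^sub>1 \<rho>\<^sub>2 \<noteq> 0"
  shows "[:- \<rho>\<^sub>1, 1:] * monic_OP (\<lambda>n. (- 1) ^ n * \<rho>\<^sub>2) (CBI_v r\<^sub>1 r\<^sub>2 \<rho>\<^sub>1 \<rho>\<^sub>2) n =
    BI_P r\<^sub>1 r\<^sub>2 \<rho>\<^sub>1 \<rho>\<^sub>2 (n + 1) - smult (BI_A r\<^sub>1 r\<^sub>2 \<rho>\<^sub>1 \<rho>\<^sub>2 n) (BI_P r\<^sub>1 r\<^sub>2 \<rho>\<^sub>1 \<rho>\<^sub>2 n)"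
proof -
  have C0: "BI_C r\<^sub>1 r\<^sub>2 \<rho>\<^sub>1 \<rho>\<^sub>2 0 = 0"
    by (simp add: BI_C_def)
  show ?thesis
    using monic_OP_christoffel[of "BI_C r\<^sub>1 r\<^sub>2 \<rho>\<^sub>1 \<rho>\<^sub>2", OF C0, of \<rho>\<^sub>1 "BI_A r\<^sub>1 r\<^sub>2 \<rho>\<^sub>1 \<rho>\<^sub>2" n]
    unfolding BI_A_C_sum[OF assms] BI_A_C_prod BI_P_eq_monic_OP[symmetric] by simp
qed

lemma CBI_W_eq_monic_OP:
  assumes "\<And>n. real n + 1 + BI_g r\<^sub>1 r\<^sub>2 \<rho>\<^sub>1 \<rho>\<^sub>2 \<noteq> 0"
  shows "CBI_W r\<^sub>1 r\<^sub>2 \<rho>\<^sub>1 \<rho>\<^sub>2 = monic_OP (\<lambda>n. (- 1) ^ n * \<rho>\<^sub>2) (CBI_v r\<^sub>1 r\<^sub>2 \<rho>\<^sub>1 \<rho>\<^sub>2)"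
  unfolding CBI_W_def CBI_division[OF assms, symmetric]
  by (intro ext nonzero_mult_div_cancel_left) simp

theorem mainTheorem7:
  fixes r\<^sub>1 r\<^sub>2 \<rho>\<^sub>1 \<rho>\<^sub>2 :: real
  assumes "\<forall>k::nat. k \<ge> 1 \<longrightarrow> BI_g r\<^sub>1 r\<^sub>2 \<rho>\<^sub>1 \<rho>\<^sub>2 \<noteq> - real k"
    and "\<rho>\<^sub>1 + \<rho>\<^sub>2 + 1 \<notin> \<int>\<^sub>\<le>\<^sub>0"
    and "\<rho>\<^sub>2 - r\<^sub>1 + 1/2 \<notin> \<int>\<^sub>\<le>\<^sub>0"
    and "\<rho>\<^sub>2 - r\<^sub>2 + 1/2 \<notin> \<int>\<^sub>\<le>\<^sub>0"
  shows
    "let g = BI_g r\<^sub>1 r\<^sub>2 \<rho>\<^sub>1 \<rho>\<^sub>2;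
         P = BI_P r\<^sub>1 r\<^sub>2 \<rho>\<^sub>1 \<rho>\<^sub>2;
         A = BI_A r\<^sub>1 r\<^sub>2 \<rho>\<^sub>1 \<rho>\<^sub>2;
         W = CBI_W r\<^sub>1 r\<^sub>2 \<rho>\<^sub>1 \<rho>\<^sub>2;
         v = CBI_v r\<^sub>1 r\<^sub>2 \<rho>\<^sub>1 \<rho>\<^sub>2
     in
       (\<forall>n. [:- \<rho>\<^sub>1, 1:] * W n = P (n + 1) - smult (A n) (P n)) \<and>
       (\<forall>n. degree (W n) = n \<and> lead_coeff (W n) = 1) \<and>
       (\<forall>n. W (n + 1) + smult ((- 1) ^ n * \<rho>\<^sub>2) (W n)
              + smult (v n) (if n = 0 then 0 else W (n - 1)) = [:0, 1:] * W n) \<and>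
       (\<exists>U V :: nat \<Rightarrow> real poly. \<forall>n.
          W (2 * n) = pcompose (U n) (monom 1 2) \<and>
          W (2 * n + 1) = [:- \<rho>\<^sub>2, 1:] * pcompose (V n) (monom 1 2) \<and>
          (\<forall>x. poly (U n) (x\<^sup>2) = CBI_kappa1 r\<^sub>1 r\<^sub>2 \<rho>\<^sub>1 \<rho>\<^sub>2 n *
                 hypergeo_4F3 (- real n) (real n + g + 1) (\<rho>\<^sub>2 + x) (\<rho>\<^sub>2 - x)
                   (\<rho>\<^sub>1 + \<rho>\<^sub>2 + 1) (\<rho>\<^sub>2 - r\<^sub>1 + 1/2) (\<rho>\<^sub>2 - r\<^sub>2 + 1/2) 1) \<and>
          (\<forall>x. poly (V n) (x\<^sup>2) = CBI_kappa2 r\<^sub>1 r\<^sub>2 \<rho>\<^sub>1 \<rho>\<^sub>2 n *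
                 hypergeo_4F3 (- real n) (real n + g + 2) (\<rho>\<^sub>2 + 1 + x) (\<rho>\<^sub>2 + 1 - x)
                   (\<rho>\<^sub>1 + \<rho>\<^sub>2 + 2) (\<rho>\<^sub>2 - r\<^sub>1 + 3/2) (\<rho>\<^sub>2 - r\<^sub>2 + 3/2) 1))"
proof -
  define g where "g = BI_g r\<^sub>1 r\<^sub>2 \<rho>\<^sub>1 \<rho>\<^sub>2"
  define v where "v = CBI_v r\<^sub>1 r\<^sub>2 \<rho>\<^sub>1 \<rho>\<^sub>2"
  define W where "W = monic_OP (\<lambda>n. (- 1) ^ n * \<rho>\<^sub>2) v"
  define h a b c where "h = g + 1" and "a = \<rho>\<^sub>1 + \<rho>\<^sub>2 + 1"
    and "b = \<rho>\<^sub>2 - r\<^sub>1 + 1/2" and "c = \<rho>\<^sub>2 - r\<^sub>2 + 1/2"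
  note pars = h_def a_def b_def c_def
  define U where "U = wilson \<rho>\<^sub>2 h a b c"
  define V where "V = wilson (\<rho>\<^sub>2 + 1) (h + 1) (a + 1) (b + 1) (c + 1)"
  have g_eq: "g = \<rho>\<^sub>1 + \<rho>\<^sub>2 - r\<^sub>1 - r\<^sub>2"
    by (simp add: g_def BI_g_def)
  have g_nz: "real n + 1 + BI_g r\<^sub>1 r\<^sub>2 \<rho>\<^sub>1 \<rho>\<^sub>2 \<noteq> 0" for n
    using assms(1)[rule_format, of "n + 1"] by (auto simp: add_eq_0_iff)
  have h: "h \<notin> \<int>\<^sub>\<le>\<^sub>0"
  proof
    assume "h \<in> \<int>\<^sub>\<le>\<^sub>0"
    then obtain n where "h = - of_nat n" by (elim nonpos_Ints_cases')
    thus False using g_nz[of n] by (simp add: h_def g_def)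
  qed
  have abc: "a \<notin> \<int>\<^sub>\<le>\<^sub>0" "b \<notin> \<int>\<^sub>\<le>\<^sub>0" "c \<notin> \<int>\<^sub>\<le>\<^sub>0"
    using assms(2-4) by (simp_all add: pars)
  have balanced: "a + b + c = h + 1 + 2 * \<rho>\<^sub>2"
    by (simp add: pars g_eq)
  have v_odd: "v (2 * n + 1) =
      - ((real n + h) * (real n + a) * (real n + b) * (real n + c) / ((2 * real n + h) * (2 * real n + h + 1)))" for n
    unfolding v_def CBI_v_def Let_def g_def[symmetric] by (simp add: pars add_ac diff_add_eq add_diff_eq)
  have v_even: "v (2 * n + 2) =
      - ((real n + 1) * (real n + 1 + h - a) * (real n + 1 + h - b) * (real n + 1 + h - c)
         / ((2 * real n + h + 2) * (2 * real n + h + 1)))" for n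
  proof -
    define N where "N = real n + 1"
    have d: "real ((2 * n + 2) div 2) = N" "2 * n + 2 \<noteq> 0" "even (2 * n + 2)"
      by (simp_all add: N_def)
    have e: "real n + 1 + h - a = N - r\<^sub>1 - r\<^sub>2" "real n + 1 + h - b = N + \<rho>\<^sub>1 - r\<^sub>2 + 1/2"
      "real n + 1 + h - c = N + \<rho>\<^sub>1 - r\<^sub>1 + 1/2" "2 * real n + h + 2 = 2 * N + 1 + g" "2 * real n + h + 1 = 2 * N + g"
      by (simp_all add: N_def pars g_eq)
    show ?thesis
      unfolding e unfolding N_def[symmetric] v_def CBI_v_def Let_def g_def[symmetric] d
      using d(2,3) by (simp only: if_True if_False) (simp add: mult_ac)
  qed
  have UV: "W (2 * n) = pcompose (U n) (monom 1 2) \<and> W (2 * n + 1) = [:- \<rho>\<^sub>2, 1:] * pcompose (V n) (monom 1 2)" for n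
    unfolding W_def
  proof (rule monic_OP_quadratic)
    show "U 0 = 1" "V 0 = 1" by (simp_all add: U_def V_def wilson_0)
    show "U (Suc n) = [:- \<rho>\<^sub>2\<^sup>2, 1:] * V n - smult (v (2 * n + 1)) (U n)" for n
      unfolding U_def V_def v_odd wilson_christoffel[OF h abc] by simp
    show "U (Suc n) = V (Suc n) + smult (v (2 * n + 2)) (V n)" for n
      unfolding U_def V_def v_even wilson_geronimus[OF h abc balanced] by simp
  qed
  have U_poly: "poly (U n) (x\<^sup>2) = CBI_kappa1 r\<^sub>1 r\<^sub>2 \<rho>\<^sub>1 \<rho>\<^sub>2 n *
      hypergeo_4F3 (- real n) (real n + g + 1) (\<rho>\<^sub>2 + x) (\<rho>\<^sub>2 - x)
        (\<rho>\<^sub>1 + \<rho>\<^sub>2 + 1) (\<rho>\<^sub>2 - r\<^sub>1 + 1/2) (\<rho>\<^sub>2 - r\<^sub>2 + 1/2) 1" for n x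
    unfolding U_def poly_wilson CBI_kappa1_def g_def[symmetric] pars by (simp add: add_ac)
  have "h + 1 = g + 2" "a + 1 = \<rho>\<^sub>1 + \<rho>\<^sub>2 + 2" "b + 1 = \<rho>\<^sub>2 - r\<^sub>1 + 3/2" "c + 1 = \<rho>\<^sub>2 - r\<^sub>2 + 3/2"
    by (simp_all add: pars)
  hence V_poly: "poly (V n) (x\<^sup>2) = CBI_kappa2 r\<^sub>1 r\<^sub>2 \<rho>\<^sub>1 \<rho>\<^sub>2 n *
      hypergeo_4F3 (- real n) (real n + g + 2) (\<rho>\<^sub>2 + 1 + x) (\<rho>\<^sub>2 + 1 - x)
        (\<rho>\<^sub>1 + \<rho>\<^sub>2 + 2) (\<rho>\<^sub>2 - r\<^sub>1 + 3/2) (\<rho>\<^sub>2 - r\<^sub>2 + 3/2) 1" for n x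
    unfolding V_def poly_wilson CBI_kappa2_def g_def[symmetric] by (simp add: add_ac)
  have W_eq: "CBI_W r\<^sub>1 r\<^sub>2 \<rho>\<^sub>1 \<rho>\<^sub>2 = W"
    unfolding W_def v_def by (rule CBI_W_eq_monic_OP) (rule g_nz)
  show ?thesis
    unfolding Let_def W_eq g_def[symmetric] v_def[symmetric]
  proof (intro conjI allI)
    fix n
    show "[:- \<rho>\<^sub>1, 1:] * W n =
        BI_P r\<^sub>1 r\<^sub>2 \<rho>\<^sub>1 \<rho>\<^sub>2 (n + 1) - smult (BI_A r\<^sub>1 r\<^sub>2 \<rho>\<^sub>1 \<rho>\<^sub>2 n) (BI_P r\<^sub>1 r\<^sub>2 \<rho>\<^sub>1 \<rho>\<^sub>2 n)"
      unfolding W_def v_def by (rule CBI_division) (rule g_nz)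
    show "degree (W n) = n" "lead_coeff (W n) = 1"
      using monic_OP_monic unfolding W_def by blast+
    show "W (n + 1) + smult ((- 1) ^ n * \<rho>\<^sub>2) (W n) + smult (v n) (if n = 0 then 0 else W (n - 1)) = [:0, 1:] * W n"
      unfolding W_def by (rule monic_OP_rec)
  qed (rule exI[of _ U], rule exI[of _ V], use UV U_poly V_poly in blast)
qed

end
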